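(* No finite cyclic group is an NNND-group. That is, for every finite cyclic group $G$ and every subset $S\subseteq G$ with $1\notin S$ such that the Cayley digraph $\mathrm{Cay}(G,S)$ is normal, every regular subgroup of $\mathrm{Aut}(\mathrm{Cay}(G,S))$ isomorphic to $G$ is normal in $\mathrm{Aut}(\mathrm{Cay}(G,S))$.
   Context: All groups and digraphs are finite; digraphs are simple. For a finite group $G$ and a subset $S\subseteq G$ with $1\notin S$, the Cayley digraph $\mathrm{Cay}(G,S)$ has vertex set $G$ and arc set $\{(g,sg) : g\in G,\ s\in S\}$ ($S$ is not required to generate $G$). For a digraph $\Gamma$, $\mathrm{Aut}(\Gamma)$ is the group of permutations of its vertex set preserving the arc set. For $g\in G$ let $R(g):x\mapsto xg$, and let $R(G)=\{R(g): g\in G\}$, a subgroup of $\mathrm{Aut}(\mathrm{Cay}(G,S))$. A subgroup of $\mathrm{Aut}(\mathrm{Cay}(G,S))$ is regular if it acts transitively on $G$ and only its identity element fixes a vertex. $\mathrm{Cay}(G,S)$ is called normal if $R(G)$ is a normal subgroup of $\mathrm{Aut}(\mathrm{Cay}(G,S))$. $\mathrm{Cay}(G,S)$ is called NNN if it is normal and $\mathrm{Aut}(\mathrm{Cay}(G,S))$ has a regular subgroup isomorphic to $G$ that is not normal in $\mathrm{Aut}(\mathrm{Cay}(G,S))$. A group $G$ is an NNND-group if there exists an NNN Cayley digraph on $G$. *)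

theory Defs
  imports "HOL-Algebra.Algebra" "Graph_Theory.Pair_Digraph"
begin

definition cayley_digraph :: "('a, 'b) monoid_scheme \<Rightarrow> 'a set \<Rightarrow> 'a pair_pre_digraph"
  where "cayley_digraph G S =
    \<lparr>pverts = carrier G, parcs = {(g, s \<otimes>\<^bsub>G\<^esub> g) | g s. g \<in> carrier G \<and> s \<in> S}\<rparr>"

definition digraph_auts :: "'a pair_pre_digraph \<Rightarrow> ('a \<Rightarrow> 'a) set"
  where "digraph_auts \<Gamma> = {f \<in> Bij (pverts \<Gamma>).
    \<forall>u \<in> pverts \<Gamma>. \<forall>v \<in> pverts \<Gamma>. (f u, f v) \<in> parcs \<Gamma> \<longleftrightarrow> (u, v) \<in> parcs \<Gamma>}"

definition digraph_Aut :: "'a pair_pre_digraph \<Rightarrow> ('a \<Rightarrow> 'a) monoid"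
  where "digraph_Aut \<Gamma> = BijGroup (pverts \<Gamma>) \<lparr>carrier := digraph_auts \<Gamma>\<rparr>"

text \<open>Permutations are extensional functions, as in \<^const>\<open>Bij\<close>, and are composed
  from right to left. Hence \<open>g \<mapsto> right_translation G g\<close> is an anti-homomorphism in general;
  its image \<open>right_regular G\<close> does not depend on the composition convention.\<close>

definition right_translation :: "('a, 'b) monoid_scheme \<Rightarrow> 'a \<Rightarrow> 'a \<Rightarrow> 'a"
  where "right_translation G g = (\<lambda>x \<in> carrier G. x \<otimes>\<^bsub>G\<^esub> g)"

definition right_regular :: "('a, 'b) monoid_scheme \<Rightarrow> ('a \<Rightarrow> 'a) set"
  where "right_regular G = right_translation G ` carrier G"

text \<open>\<open>A\<close> is a group of permutations of \<open>V\<close>.\<close>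

definition regular_subgroup :: "('v \<Rightarrow> 'v) set \<Rightarrow> ('v \<Rightarrow> 'v) monoid \<Rightarrow> 'v set \<Rightarrow> bool"
  where "regular_subgroup H A V \<longleftrightarrow>
    subgroup H A \<and>
    transitive_action (A\<lparr>carrier := H\<rparr>) V (\<lambda>f. f) \<and>
    (\<forall>f \<in> H. \<forall>x \<in> V. f x = x \<longrightarrow> f = \<one>\<^bsub>A\<^esub>)"

definition normal_cayley_digraph :: "('a, 'b) monoid_scheme \<Rightarrow> 'a set \<Rightarrow> bool"
  where "normal_cayley_digraph G S \<longleftrightarrow>
    right_regular G \<lhd> digraph_Aut (cayley_digraph G S)"

definition NNN_cayley_digraph :: "('a, 'b) monoid_scheme \<Rightarrow> 'a set \<Rightarrow> bool"
  where "NNN_cayley_digraph G S \<longleftrightarrow>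
    normal_cayley_digraph G S \<and>
    (\<exists>H. regular_subgroup H (digraph_Aut (cayley_digraph G S)) (carrier G) \<and>
         (digraph_Aut (cayley_digraph G S))\<lparr>carrier := H\<rparr> \<cong> G \<and>
         \<not> H \<lhd> digraph_Aut (cayley_digraph G S))"

definition NNND_group :: "('a, 'b) monoid_scheme \<Rightarrow> bool"
  where "NNND_group G \<longleftrightarrow>
    (\<exists>S. S \<subseteq> carrier G \<and> \<one>\<^bsub>G\<^esub> \<notin> S \<and> NNN_cayley_digraph G S)"


lemma (in group) pair_digraph_cayley_digraph:
  assumes "finite (carrier G)" "S \<subseteq> carrier G" "\<one> \<notin> S"
  shows "pair_digraph (cayley_digraph G S)"
proof
  have sub: "parcs (cayley_digraph G S) \<subseteq> carrier G \<times> carrier G"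
    using assms by (auto simp: cayley_digraph_def)
  show "finite (parcs (cayley_digraph G S))"
    using finite_subset[OF sub] assms by simp
  show "finite (pverts (cayley_digraph G S))"
    using assms by (simp add: cayley_digraph_def)
  fix e assume e: "e \<in> parcs (cayley_digraph G S)"
  show "fst e \<in> pverts (cayley_digraph G S)" "snd e \<in> pverts (cayley_digraph G S)"
    using subsetD[OF sub e] by (auto simp: cayley_digraph_def)
  from e obtain g s where gs: "e = (g, s \<otimes> g)" "g \<in> carrier G" "s \<in> S"
    by (auto simp: cayley_digraph_def)
  moreover have "s \<otimes> g \<noteq> g"
    using gs assms r_cancel_one by blast
  ultimately show "fst e \<noteq> snd e" by simp
qed

lemma subgroup_digraph_auts: "subgroup (digraph_auts \<Gamma>) (BijGroup (pverts \<Gamma>))"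
proof (rule subgroup.intro)
  show "digraph_auts \<Gamma> \<subseteq> carrier (BijGroup (pverts \<Gamma>))"
    by (auto simp: digraph_auts_def BijGroup_def)
next
  fix f g assume "f \<in> digraph_auts \<Gamma>" "g \<in> digraph_auts \<Gamma>"
  moreover from this have "g \<in> pverts \<Gamma> \<rightarrow> pverts \<Gamma>"
    by (auto simp: digraph_auts_def dest: Bij_imp_funcset)
  ultimately show "f \<otimes>\<^bsub>BijGroup (pverts \<Gamma>)\<^esub> g \<in> digraph_auts \<Gamma>"
    by (auto simp: digraph_auts_def BijGroup_def compose_Bij compose_eq Pi_iff)
next
  show "\<one>\<^bsub>BijGroup (pverts \<Gamma>)\<^esub> \<in> digraph_auts \<Gamma>"
    by (auto simp: digraph_auts_def BijGroup_def id_Bij)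
next
  fix f assume f: "f \<in> digraph_auts \<Gamma>"
  then have fB: "f \<in> Bij (pverts \<Gamma>)" by (simp add: digraph_auts_def)
  define h where "h = inv_into (pverts \<Gamma>) f"
  have h: "h u \<in> pverts \<Gamma>" "f (h u) = u" if "u \<in> pverts \<Gamma>" for u
    using fB that by (auto simp: h_def Bij_def bij_betw_def inv_into_into f_inv_into_f)
  have "(h u, h v) \<in> parcs \<Gamma> \<longleftrightarrow> (u, v) \<in> parcs \<Gamma>"
    if "u \<in> pverts \<Gamma>" "v \<in> pverts \<Gamma>" for u v
    using f h[OF that(1)] h[OF that(2)] by (force simp: digraph_auts_def)
  then show "inv\<^bsub>BijGroup (pverts \<Gamma>)\<^esub> f \<in> digraph_auts \<Gamma>"
    using restrict_inv_into_Bij[OF fB]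
    by (simp add: inv_BijGroup[OF fB] digraph_auts_def flip: h_def)
qed

lemma group_digraph_Aut: "group (digraph_Aut \<Gamma>)"
  unfolding digraph_Aut_def
  by (rule subgroup.subgroup_is_group[OF subgroup_digraph_auts group_BijGroup])

lemma (in group) right_translation_in_digraph_auts:
  assumes "S \<subseteq> carrier G" "g \<in> carrier G"
  shows "right_translation G g \<in> digraph_auts (cayley_digraph G S)"
proof -
  have "bij_betw (\<lambda>x. x \<otimes> g) (carrier G) (carrier G)"
    by (rule bij_betwI[where g = "\<lambda>x. x \<otimes> inv g"]) (use assms in \<open>auto simp: m_assoc\<close>)
  then have "right_translation G g \<in> Bij (carrier G)"
    by (simp add: right_translation_def Bij_def cong: bij_betw_cong)
  moreover have "(u \<otimes> g, v \<otimes> g) \<in> parcs (cayley_digraph G S) \<longleftrightarrow>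
      (u, v) \<in> parcs (cayley_digraph G S)"
    if uv: "u \<in> carrier G" "v \<in> carrier G" for u v
  proof -
    have "v \<otimes> g = s \<otimes> (u \<otimes> g) \<longleftrightarrow> v = s \<otimes> u" if "s \<in> S" for s
    proof -
      have "s \<in> carrier G" using assms that by blast
      then show ?thesis
        using uv assms right_cancel[of g v "s \<otimes> u"] by (simp add: m_assoc)
    qed
    then show ?thesis
      using uv assms by (auto simp: cayley_digraph_def)
  qed
  ultimately show ?thesis
    by (simp add: digraph_auts_def right_translation_def)
      (simp add: cayley_digraph_def)
qed

lemma (in group) regular_subgroup_right_regular:
  assumes "S \<subseteq> carrier G"
  shows "regular_subgroup (right_regular G) (digraph_Aut (cayley_digraph G S)) (carrier G)"
proof -
  let ?A = "digraph_Aut (cayley_digraph G S)" and ?R = "right_translation G"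
  interpret A: group ?A by (rule group_digraph_Aut)
  have V: "pverts (cayley_digraph G S) = carrier G"
    by (simp add: cayley_digraph_def)
  have Bij: "?R g \<in> Bij (carrier G)" if "g \<in> carrier G" for g
    using right_translation_in_digraph_auts[OF assms that] by (simp add: digraph_auts_def V)
  have mult: "?R g \<otimes>\<^bsub>?A\<^esub> ?R h = ?R (h \<otimes> g)" if "g \<in> carrier G" "h \<in> carrier G" for g h
  proof -
    have "compose (carrier G) (?R g) (?R h) = ?R (h \<otimes> g)"
      unfolding compose_def right_translation_def
      by (rule restrict_ext) (use that in \<open>simp add: m_assoc\<close>)
    then show ?thesis
      using that by (simp add: digraph_Aut_def BijGroup_def V Bij)
  qed
  have one: "\<one>\<^bsub>?A\<^esub> = ?R \<one>"
    by (auto simp: digraph_Aut_def BijGroup_def V right_translation_def intro: restrict_ext)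
  have carr: "?R g \<in> carrier ?A" if "g \<in> carrier G" for g
    using right_translation_in_digraph_auts[OF assms that] by (simp add: digraph_Aut_def)
  have inv: "inv\<^bsub>?A\<^esub> ?R g = ?R (inv g)" if "g \<in> carrier G" for g
    by (rule A.inv_equality) (use that in \<open>auto simp: mult one carr\<close>)
  have sub: "subgroup (right_regular G) ?A"
    by (rule subgroup.intro) (auto simp: right_regular_def carr mult inv one)
  have "transitive_action (?A\<lparr>carrier := right_regular G\<rparr>) (carrier G) (\<lambda>f. f)"
  proof (intro transitive_action.intro group_action.intro transitive_action_axioms.intro)
    show "group_hom (?A\<lparr>carrier := right_regular G\<rparr>) (BijGroup (carrier G)) (\<lambda>f. f)"
      using subgroup.subgroup_is_group[OF sub A.is_group] group_BijGroup
      by (auto simp: group_hom_def group_hom_axioms_def hom_def right_regular_def Bij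
          BijGroup_def digraph_Aut_def V)
    fix x y assume "x \<in> carrier G" "y \<in> carrier G"
    then have "inv x \<otimes> y \<in> carrier G" "?R (inv x \<otimes> y) x = y"
      using m_assoc[of x "inv x" y] by (simp_all add: right_translation_def)
    then show "\<exists>g \<in> carrier (?A\<lparr>carrier := right_regular G\<rparr>). g x = y"
      by (auto simp: right_regular_def)
  qed
  moreover have "g = \<one>" if "g \<in> carrier G" "x \<in> carrier G" "?R g x = x" for g x
    using that by (simp add: right_translation_def)
  ultimately show ?thesis
    using sub by (auto simp: regular_subgroup_def right_regular_def one)
qed

end

theory Submission
  imports Defs
begin

text \<open>Identify \<open>G\<close> with the integers modulo \<open>n\<close>. Normality makes every automorphism affine, so a
  regular cyclic subgroup is generated by some \<open>x \<mapsto> a * x + b\<close>; by regularity the orbits of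
  multiplication by \<open>a\<close>, under which \<open>S\<close> is invariant, are the cosets \<open>s + (a - 1) * s * \<int>\<close>.
  If \<open>2 * (a - 1)\<close> did not vanish modulo \<open>n\<close>, then for some prime \<open>p\<close> dividing \<open>n\<close> the elements of
  \<open>S\<close> outside the multiples of \<open>p\<close> would be invariant under a translation by some \<open>h\<close> with
  \<open>2 * h \<noteq> 0\<close>, and translating only the multiples of \<open>p\<close> by \<open>h\<close> would be an automorphism that
  is not affine. So \<open>2 * (a - 1) = 0\<close>, and then the subgroup is normal by direct computation.\<close>

section \<open>Cyclic groups and composition of automorphisms\<close>

text \<open>Natural exponents are wanted because the powers of a generator of the regular subgroup
  are described by geometric sums. Negative exponents reduce modulo the positive order of the
  generator.\<close>

lemma (in group) finite_cyclic_group_nat_pow: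
  assumes "finite (carrier G)" "cyclic_group G"
  obtains x where "x \<in> carrier G" "carrier G = range (\<lambda>k::nat. x [^] k)"
proof -
  obtain x where x: "x \<in> carrier G" "carrier G = range (\<lambda>i::int. x [^] i)"
    using assms(2) cyclic_group by auto
  have pos: "ord x > 0"
    using assms(1) x(1) ord_ge_1 by fastforce
  have "x [^] i \<in> range (\<lambda>k::nat. x [^] k)" for i :: int
  proof -
    have "x [^] i = x [^] int (nat (i mod int (ord x)))"
      using pos by (simp add: int_pow_eq[OF x(1)] dvd_minus_mod mod_eq_dvd_iff[symmetric])
    then show ?thesis by (metis int_pow_int rangeI)
  qed
  then have "carrier G = range (\<lambda>k::nat. x [^] k)"
    using x by (metis image_subsetI nat_pow_closed subset_antisym)
  with x(1) show thesis by (rule that)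
qed

lemma Aut_mult_apply:
  assumes "f \<in> digraph_auts \<Gamma>" "g \<in> digraph_auts \<Gamma>" "x \<in> pverts \<Gamma>"
  shows "(f \<otimes>\<^bsub>digraph_Aut \<Gamma>\<^esub> g) x = f (g x)"
  using assms by (simp add: digraph_Aut_def BijGroup_def digraph_auts_def compose_eq)

lemma carrier_digraph_Aut [simp]: "carrier (digraph_Aut \<Gamma>) = digraph_auts \<Gamma>"
  by (simp add: digraph_Aut_def)

lemma digraph_auts_closed: "f \<in> digraph_auts \<Gamma> \<Longrightarrow> x \<in> pverts \<Gamma> \<Longrightarrow> f x \<in> pverts \<Gamma>"
  by (auto simp: digraph_auts_def dest: Bij_imp_funcset)

lemma digraph_auts_eqI:
  assumes "f \<in> digraph_auts \<Gamma>" "g \<in> digraph_auts \<Gamma>" "\<And>x. x \<in> pverts \<Gamma> \<Longrightarrow> f x = g x"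
  shows "f = g"
  using assms by (auto simp: digraph_auts_def intro: extensionalityI dest!: Bij_imp_extensional)

section \<open>Arithmetic of affine maps modulo \<open>n\<close>\<close>

definition geo :: "int \<Rightarrow> nat \<Rightarrow> int"
  where "geo a k = (\<Sum>i<k. a ^ i)"

text \<open>The division-free form of the geometric sum: \<open>a - 1\<close> need not be invertible
  modulo \<open>n\<close>.\<close>

lemma power_eq_geo: "a ^ k = 1 + (a - 1) * geo a k"
  using power_diff_1_eq[of a k] by (simp add: geo_def)

lemma geo_Suc: "geo a (Suc k) = a * geo a k + 1"
  using power_eq_geo[of a k] by (simp add: geo_def algebra_simps)

text \<open>The maps \<open>x \<mapsto> a * x + b\<close> that permute the integers modulo \<open>n\<close> in a single cycle:
  \<open>b * geo a k\<close> is the image of \<open>0\<close> under the \<open>k\<close>-th iterate.\<close>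

locale full_cycle =
  fixes n a b :: int
  assumes pos: "n > 0"
    and inj: "\<And>i. n dvd a * i \<Longrightarrow> n dvd i"
    and surj: "\<And>t. \<exists>k. n dvd b * geo a k - t"
begin

lemma coprime_b: "coprime n b"
proof -
  obtain k where k: "n dvd b * geo a k - 1" using surj by blast
  show ?thesis
  proof (rule coprimeI)
    fix c assume "c dvd n" "c dvd b"
    then have "c dvd b * geo a k - (b * geo a k - 1)"
      using k by (meson dvd_diff dvd_mult2 dvd_trans)
    then show "is_unit c" by simp
  qed
qed

text \<open>As \<open>b\<close> is a unit modulo \<open>n\<close>, it cancels from the description
  of the orbit of 0.\<close>

lemma geo_surj: "\<exists>k. n dvd geo a k - t"
proof -
  obtain k where "n dvd b * geo a k - b * t" using surj by blast
  then have "n dvd b * (geo a k - t)" by (simp add: algebra_simps)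
  then show ?thesis using coprime_dvd_mult_right_iff[OF coprime_b] by auto
qed

text \<open>If \<open>a - 1\<close> had an inverse \<open>u\<close> modulo \<open>p\<close>, some
  \<open>geo a k\<close> would be \<open>- u\<close>, which makes \<open>a ^ k\<close> vanish modulo
  \<open>p\<close>. Then \<open>p\<close> divides \<open>a\<close>, and multiplication by
  \<open>a\<close> kills the nonzero residue \<open>n / p\<close>.\<close>

lemma prime_dvd_diff:
  assumes "Factorial_Ring.prime p" "p dvd n"
  shows "p dvd a - 1"
proof (rule ccontr)
  assume np: "\<not> p dvd a - 1"
  then have "coprime p (a - 1)" using assms(1) by (simp add: prime_imp_coprime)
  then obtain u v where uv: "u * (a - 1) + v * p = 1"
    using bezout_int[of "a - 1" p] by (auto simp: coprime_iff_gcd_eq_1 gcd.commute)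
  obtain k where "n dvd geo a k - (- u)" using geo_surj by blast
  with assms(2) have "p dvd geo a k - (- u)" by (rule dvd_trans)
  moreover have "a ^ k = (a - 1) * (geo a k - (- u)) + v * p"
  proof -
    have "a ^ k = (u * (a - 1) + v * p) + (a - 1) * geo a k"
      unfolding uv by (rule power_eq_geo)
    then show ?thesis by (simp add: algebra_simps)
  qed
  ultimately have "p dvd a ^ k" by (metis dvd_add dvd_mult dvd_mult2 dvd_triv_right)
  with assms(1) have "p dvd a" by (rule prime_dvd_power)
  moreover obtain i where i: "n = p * i" using assms(2) by blast
  ultimately have "n dvd a * i" by (simp add: mult_dvd_mono)
  then have "n dvd i" by (rule inj)
  moreover have p: "p > 1" using assms(1) by (rule prime_gt_1_int)
  moreover have "i > 0" using pos p i by (simp add: zero_less_mult_iff)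
  ultimately show False
    using i zdvd_not_zless[of i n] by simp
qed

text \<open>For even \<open>n\<close> one factor \<open>a - 1\<close> supplies the 2; for odd
  \<open>n\<close> the 2 cancels.\<close>

lemma square_diff_dvd:
  assumes "n dvd 2 * (a - 1)"
  shows "n dvd (a - 1) * (a - 1)"
proof (cases "even n")
  case True
  then have "2 dvd a - 1" by (intro prime_dvd_diff) auto
  then obtain c where "a - 1 = 2 * c" by blast
  then have "(a - 1) * (a - 1) = 2 * (a - 1) * c" by simp
  then show ?thesis using assms by (simp only: dvd_mult2)
next
  case False
  then have "coprime n 2" by simp
  then have "n dvd a - 1" using assms coprime_dvd_mult_right_iff[of n 2 "a - 1"] by blast
  then show ?thesis by simp
qed

text \<open>As \<open>a ^ k * s = s + (a - 1) * s * geo a k\<close>, the orbit of \<open>s\<close> under multiplication by \<open>a\<close>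
  is the full coset of the multiples of \<open>(a - 1) * s\<close>.\<close>

lemma obtain_shift:
  assumes "\<not> n dvd 2 * (a - 1)"
  obtains p h where "Factorial_Ring.prime p" "p dvd n" "p dvd h" "\<not> n dvd 2 * h"
    "\<And>s. \<not> p dvd s \<Longrightarrow> \<exists>k. n dvd a ^ k * s - (s + h)"
proof -
  let ?m = "a - 1"
  have nz: "2 * ?m \<noteq> 0" using assms by (metis dvd_0_right)
  obtain p where p: "Factorial_Ring.prime p" "multiplicity p (2 * ?m) < multiplicity p n"
    using multiplicity_le_imp_dvd[of n "2 * ?m"] assms pos by (metis not_le less_irrefl)
  define e where "e = multiplicity p n"
  have "p ^ e dvd n" by (simp add: e_def multiplicity_dvd)
  then obtain n' where n': "n = p ^ e * n'" by blast
  have ndvd: "\<not> p ^ e dvd 2 * ?m"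
    using p(2) power_dvd_iff_le_multiplicity[OF nz, of p e] not_prime_unit p(1)
    by (auto simp: e_def not_le)
  have "e > 0" using p by (simp add: e_def)
  then have pn: "p dvd n" using n' by (simp add: dvd_power)
  \<comment> \<open>The shift is \<open>h = (a - 1) * n'\<close>, where \<open>n'\<close> is the
    cofactor of the full power of \<open>p\<close> in \<open>n\<close>.\<close>
  show thesis
  proof
    show "Factorial_Ring.prime p" "p dvd n" by fact+
    show "p dvd ?m * n'" using prime_dvd_diff[OF p(1) pn] by simp
    have "n' \<noteq> 0" using n' pos by auto
    then show "\<not> n dvd 2 * (?m * n')"
      using ndvd n' by (metis dvd_times_right_cancel_iff mult.assoc)
    fix s assume "\<not> p dvd s"
    then have "coprime s (p ^ e)" using p(1) by (simp add: prime_imp_coprime coprime_commute)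
    then obtain c v where cv: "c * s + v * p ^ e = 1"
      using bezout_int[of s "p ^ e"] by (auto simp: coprime_iff_gcd_eq_1)
    \<comment> \<open>With \<open>c\<close> inverse to \<open>s\<close> modulo \<open>p ^ e\<close>,
      this choice makes \<open>(a - 1) * s * geo a k\<close> congruent to \<open>h\<close>: the
      error contains both \<open>n'\<close> and \<open>p ^ e\<close>.\<close>
    obtain k where k: "n dvd geo a k - n' * c" using geo_surj by blast
    have "?m * n' = ?m * n' * (c * s + v * p ^ e)" by (simp only: cv mult_1_right)
    then have "a ^ k * s - (s + ?m * n') = ?m * s * (geo a k - n' * c) - ?m * v * n"
      unfolding power_eq_geo[of a k] n' by (simp only: algebra_simps)
    then have "n dvd a ^ k * s - (s + ?m * n')"
      using k by (metis dvd_diff dvd_mult dvd_triv_right)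
    then show "\<exists>k. n dvd a ^ k * s - (s + ?m * n')" by blast
  qed
qed

end

section \<open>Cayley digraphs on a cyclic group, in exponents of a generator\<close>

locale finite_cyclic_cayley = group G for G (structure) +
  fixes z S
  assumes fin: "finite (carrier G)"
    and z_closed [simp]: "z \<in> carrier G"
    and carrier_eq: "carrier G = range (\<lambda>i::int. z [^] i)"
    and S_sub: "S \<subseteq> carrier G"
begin

abbreviation "n \<equiv> int (ord z)"
abbreviation "\<Gamma> \<equiv> cayley_digraph G S"
abbreviation "A \<equiv> digraph_Aut \<Gamma>"

definition affine :: "('a \<Rightarrow> 'a) \<Rightarrow> int \<Rightarrow> int \<Rightarrow> bool"
  where "affine f a b \<longleftrightarrow> (\<forall>i. f (z [^] i) = z [^] (a * i + b))"

lemma n_pos: "n > 0"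
  using fin ord_ge_1[of z] by simp

lemma pow_eq_iff: "z [^] (i::int) = z [^] j \<longleftrightarrow> n dvd i - j"
  using int_pow_eq[of z i j] by (simp add: dvd_diff_commute)

lemma pverts [simp]: "pverts \<Gamma> = carrier G"
  by (simp add: cayley_digraph_def)

lemma A_group: "group A"
  by (rule group_digraph_Aut)

lemma arc_iff: "(z [^] (i::int), z [^] (j::int)) \<in> parcs \<Gamma> \<longleftrightarrow> z [^] (j - i) \<in> S"
proof -
  have "z [^] j = s \<otimes> z [^] i \<longleftrightarrow> s = z [^] (j - i)" if "s \<in> S" for s
  proof -
    have "z [^] j = z [^] (j - i) \<otimes> z [^] i" by (simp flip: int_pow_mult)
    moreover have "s \<in> carrier G" using that S_sub by blast
    ultimately show ?thesis by (metis int_pow_closed right_cancel z_closed)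
  qed
  then show ?thesis by (auto simp: cayley_digraph_def)
qed

lemma auts_eqI:
  assumes "f \<in> digraph_auts \<Gamma>" "g \<in> digraph_auts \<Gamma>" "\<And>i. f (z [^] (i::int)) = g (z [^] i)"
  shows "f = g"
  by (rule digraph_auts_eqI[OF assms(1,2)]) (use assms(3) carrier_eq in auto)

text \<open>Conjugation by \<open>f\<close> turns translation by \<open>z\<close> into translation
  by some \<open>w = z [^] a\<close>, so raising the exponent of the argument by 1 raises that of
  the value by \<open>a\<close>.\<close>

lemma normal_imp_affine:
  assumes "normal_cayley_digraph G S" and f: "f \<in> digraph_auts \<Gamma>"
  obtains a b where "affine f a b"
proof -
  let ?R = "right_translation G"
  interpret A: group A by (rule A_group)
  have Rz: "?R z \<in> digraph_auts \<Gamma>"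
    by (rule right_translation_in_digraph_auts) (use S_sub in auto)
  have "f \<otimes>\<^bsub>A\<^esub> ?R z \<otimes>\<^bsub>A\<^esub> inv\<^bsub>A\<^esub> f \<in> right_regular G"
    using assms(1) f by (intro normal.inv_op_closed2)
      (auto simp: normal_cayley_digraph_def right_regular_def)
  then obtain w where w: "w \<in> carrier G" "f \<otimes>\<^bsub>A\<^esub> ?R z \<otimes>\<^bsub>A\<^esub> inv\<^bsub>A\<^esub> f = ?R w"
    by (auto simp: right_regular_def)
  have Rw: "?R w \<in> digraph_auts \<Gamma>"
    by (rule right_translation_in_digraph_auts) (use S_sub w in auto)
  have "f \<otimes>\<^bsub>A\<^esub> ?R z = ?R w \<otimes>\<^bsub>A\<^esub> f"
    using A.inv_solve_right'[of "?R w" "f \<otimes>\<^bsub>A\<^esub> ?R z" f] A.m_closed[of f "?R z"] w(2) f Rz Rw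
    by simp
  then have "f (?R z x) = ?R w (f x)" if "x \<in> carrier G" for x
    using that Aut_mult_apply[of f \<Gamma> "?R z" x] Aut_mult_apply[of "?R w" \<Gamma> f x] f Rz Rw by simp
  then have step: "f (x \<otimes> z) = f x \<otimes> w" if "x \<in> carrier G" for x
    using that digraph_auts_closed[OF f, of x] by (simp add: right_translation_def)
  obtain a where a: "w = z [^] (a::int)" using w(1) carrier_eq by auto
  have "f \<one> \<in> carrier G" using digraph_auts_closed[OF f, of \<one>] by simp
  then obtain b where b: "f \<one> = z [^] (b::int)" using carrier_eq by auto
  have suc: "f (z [^] (i + 1)) = f (z [^] i) \<otimes> z [^] a" for i :: int
    using step[of "z [^] i"] by (simp add: int_pow_mult a)
  have "f (z [^] i) = z [^] (a * i + b)" for i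
  proof (induction i rule: int_induct[where k = 0])
    case base
    show ?case by (simp add: b)
  next
    case (step1 i)
    have "f (z [^] (i + 1)) = z [^] (a * i + b) \<otimes> z [^] a"
      using step1 by (simp only: suc)
    also have "\<dots> = z [^] (a * (i + 1) + b)"
      by (simp add: algebra_simps flip: int_pow_mult)
    finally show ?case .
  next
    case (step2 i)
    have "f (z [^] (i - 1)) \<in> carrier G" using digraph_auts_closed[OF f] by simp
    moreover have "f (z [^] (i - 1)) \<otimes> z [^] a = z [^] (a * (i - 1) + b) \<otimes> z [^] a"
      using suc[of "i - 1"] step2 by (simp add: algebra_simps flip: int_pow_mult)
    ultimately show ?case by simp
  qed
  then show thesis using that affine_def by blast
qed

lemma affine_inj:
  assumes "affine f a b" "f \<in> digraph_auts \<Gamma>" "n dvd a * i"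
  shows "n dvd i"
proof -
  have "inj_on f (carrier G)"
    using assms(2) by (simp add: digraph_auts_def Bij_def bij_betw_def)
  moreover have "f (z [^] i) = f (z [^] (0::int))"
    using assms(1,3) unfolding affine_def by (simp only: pow_eq_iff) simp
  ultimately have "z [^] i = z [^] (0::int)"
    by (meson inj_onD int_pow_closed z_closed)
  then show ?thesis by (simp only: pow_eq_iff) simp
qed

text \<open>Arcs depend only on differences of exponents, so \<open>b\<close> cancels.\<close>

lemma affine_S:
  assumes "affine f a b" "f \<in> digraph_auts \<Gamma>"
  shows "z [^] (a * i) \<in> S \<longleftrightarrow> z [^] i \<in> S"
proof -
  have "(f (z [^] (0::int)), f (z [^] i)) \<in> parcs \<Gamma> \<longleftrightarrow> (z [^] (0::int), z [^] i) \<in> parcs \<Gamma>"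
    using assms(2) by (simp add: digraph_auts_def)
  moreover have "f (z [^] (0::int)) = z [^] b" "f (z [^] i) = z [^] (a * i + b)"
    using assms(1) by (simp_all only: affine_def) simp
  ultimately show ?thesis by (simp only: arc_iff) simp
qed

lemma affine_power_S:
  assumes "affine f a b" "f \<in> digraph_auts \<Gamma>"
  shows "z [^] (a ^ k * i) \<in> S \<longleftrightarrow> z [^] i \<in> S"
  by (induction k) (use affine_S[OF assms] in \<open>simp_all add: mult.assoc\<close>)

lemma affine_power:
  assumes "affine f a b" "f \<in> digraph_auts \<Gamma>"
  shows "f [^]\<^bsub>A\<^esub> k \<in> digraph_auts \<Gamma>" "affine (f [^]\<^bsub>A\<^esub> k) (a ^ k) (b * geo a k)"
proof -
  interpret A: group A by (rule A_group)
  show cl: "f [^]\<^bsub>A\<^esub> k \<in> digraph_auts \<Gamma>" for k :: nat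
    using A.nat_pow_closed[of f k] assms(2) by simp
  show "affine (f [^]\<^bsub>A\<^esub> k) (a ^ k) (b * geo a k)"
  proof (induction k)
    case 0
    have "\<one>\<^bsub>A\<^esub> (z [^] i) = z [^] i" for i :: int
      by (simp add: digraph_Aut_def BijGroup_def)
    then show ?case by (simp add: affine_def geo_def)
  next
    case (Suc k)
    have "f [^]\<^bsub>A\<^esub> Suc k = f \<otimes>\<^bsub>A\<^esub> f [^]\<^bsub>A\<^esub> k"
      using assms(2) by (intro A.nat_pow_Suc2) simp
    then have "(f [^]\<^bsub>A\<^esub> Suc k) (z [^] i) = f ((f [^]\<^bsub>A\<^esub> k) (z [^] i))" for i :: int
      using Aut_mult_apply[OF assms(2) cl] by simp
    then show ?case
      using Suc assms(1) by (simp add: affine_def geo_Suc algebra_simps)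
  qed
qed

text \<open>The case split is on membership in the subgroup generated by \<open>z [^] p\<close>,
  since exponents are determined only modulo \<open>n\<close>.\<close>

definition shift_multiples :: "int \<Rightarrow> int \<Rightarrow> 'a \<Rightarrow> 'a"
  where "shift_multiples p h =
    (\<lambda>x \<in> carrier G. if x \<in> (\<lambda>i. z [^] (p * i)) ` UNIV then x \<otimes> z [^] h else x)"

lemma shift_multiples_pow:
  assumes "p dvd n"
  shows "shift_multiples p h (z [^] (i::int)) = z [^] (if p dvd i then i + h else i)"
proof -
  have "z [^] i \<in> (\<lambda>i. z [^] (p * i)) ` UNIV \<longleftrightarrow> p dvd i"
  proof
    assume "z [^] i \<in> (\<lambda>i. z [^] (p * i)) ` UNIV"
    then obtain j where "n dvd i - p * j" using pow_eq_iff by auto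
    then have "p dvd i - p * j" using assms dvd_trans by blast
    from dvd_add[OF this dvd_triv_left[of p j]] show "p dvd i" by simp
  qed (auto elim!: dvdE)
  then show ?thesis by (simp add: shift_multiples_def int_pow_mult)
qed

text \<open>The difference of two exponents changes only if exactly one is a multiple of
  \<open>p\<close>. It is then not a multiple of \<open>p\<close> and changes by \<open>h\<close> or
  \<open>- h\<close>, to which \<open>S\<close> is insensitive there.\<close>

lemma shift_multiples_aut:
  assumes "p dvd n" "p dvd h"
    and S: "\<And>s::int. \<not> p dvd s \<Longrightarrow> z [^] (s + h) \<in> S \<longleftrightarrow> z [^] s \<in> S"
  shows "shift_multiples p h \<in> digraph_auts \<Gamma>"
proof -
  let ?f = "shift_multiples p h" and ?g = "shift_multiples p (- h)"
  note sh = shift_multiples_pow[OF assms(1)]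
  have "bij_betw ?f (carrier G) (carrier G)"
    by (rule bij_betwI[where g = ?g]) (use assms(2) in \<open>auto simp: carrier_eq sh\<close>)
  then have "?f \<in> Bij (carrier G)"
    by (simp add: Bij_def shift_multiples_def)
  moreover have "(?f (z [^] i), ?f (z [^] j)) \<in> parcs \<Gamma> \<longleftrightarrow> (z [^] i, z [^] j) \<in> parcs \<Gamma>"
    for i j :: int
  proof -
    have 1: "z [^] (j + h - i) \<in> S \<longleftrightarrow> z [^] (j - i) \<in> S" if "\<not> p dvd j - i"
      using S[OF that] by (simp add: algebra_simps)
    have 2: "z [^] (j - (i + h)) \<in> S \<longleftrightarrow> z [^] (j - i) \<in> S" if "\<not> p dvd j - i"
    proof -
      have "\<not> p dvd j - (i + h)" using that assms(2)
        by (metis diff_diff_eq dvd_diff_left_iff)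
      from S[OF this] show ?thesis by simp
    qed
    have 3: "\<not> p dvd j - i" if "(p dvd i) \<noteq> (p dvd j)"
      using that dvd_diff_left_iff dvd_diff_right_iff by blast
    show ?thesis
      using 1 2 3 by (cases "p dvd i"; cases "p dvd j") (simp_all add: sh arc_iff)
  qed
  ultimately show ?thesis
    by (auto simp: digraph_auts_def carrier_eq)
qed

section \<open>Regular cyclic subgroups\<close>

lemma regular_affine_full_cycle:
  assumes "regular_subgroup H A (carrier G)"
    and \<sigma>: "\<sigma> \<in> digraph_auts \<Gamma>" "affine \<sigma> a b" "H = range (\<lambda>k::nat. \<sigma> [^]\<^bsub>A\<^esub> k)"
  shows "full_cycle n a b"
proof
  show "n > 0" by (rule n_pos)
  show "n dvd i" if "n dvd a * i" for i
    using affine_inj[OF \<sigma>(2,1) that] .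
  fix t :: int
  have "transitive_action (A\<lparr>carrier := H\<rparr>) (carrier G) (\<lambda>f. f)"
    using assms(1) by (simp add: regular_subgroup_def)
  from transitive_action.unique_orbit[OF this, of "z [^] (0::int)" "z [^] t"]
  obtain k where k: "(\<sigma> [^]\<^bsub>A\<^esub> (k::nat)) (z [^] (0::int)) = z [^] t"
    using \<sigma>(3) by auto
  have "(\<sigma> [^]\<^bsub>A\<^esub> k) (z [^] (0::int)) = z [^] (a ^ k * 0 + b * geo a k)"
    using affine_power(2)[OF \<sigma>(2,1), of k] unfolding affine_def by blast
  with k have "z [^] (b * geo a k) = z [^] t" by simp
  then have "n dvd b * geo a k - t" by (simp only: pow_eq_iff)
  then show "\<exists>k. n dvd b * geo a k - t" by blast
qed

text \<open>Otherwise some \<^const>\<open>shift_multiples\<close> would be an automorphism, hence affine; it maps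
  \<open>0, 1, -1\<close> to \<open>h, 1, -1\<close>, and affine maps preserve the midpoint of \<open>1\<close> and \<open>-1\<close>.\<close>

lemma full_cycle_dvd:
  assumes normal: "normal_cayley_digraph G S"
    and \<sigma>: "\<sigma> \<in> digraph_auts \<Gamma>" "affine \<sigma> a b" "full_cycle n a b"
  shows "n dvd 2 * (a - 1)"
proof (rule ccontr)
  assume "\<not> n dvd 2 * (a - 1)"
  from full_cycle.obtain_shift[OF \<sigma>(3) this]
  obtain p h where p: "Factorial_Ring.prime p" "p dvd n" "p dvd h" "\<not> n dvd 2 * h"
    and k: "\<And>s. \<not> p dvd s \<Longrightarrow> \<exists>k. n dvd a ^ k * s - (s + h)" by metis
  have "z [^] (s + h) \<in> S \<longleftrightarrow> z [^] s \<in> S" if "\<not> p dvd s" for s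
    using k[OF that] affine_power_S[OF \<sigma>(2,1)] by (metis pow_eq_iff)
  then have f: "shift_multiples p h \<in> digraph_auts \<Gamma>"
    using shift_multiples_aut p by blast
  obtain c d where cd: "affine (shift_multiples p h) c d"
    using normal_imp_affine[OF normal f] by blast
  have *: "z [^] (c * i + d) = z [^] (if p dvd i then i + h else i)" for i
    using shift_multiples_pow[OF p(2), of h i] cd unfolding affine_def by metis
  have "\<not> p dvd 1" using prime_gt_1_int[OF p(1)] by simp
  then have "n dvd d - h" "n dvd c + d - 1" "n dvd d - c + 1"
    using *[of 0] *[of 1] *[of "- 1"] unfolding pow_eq_iff by simp_all
  from this(2,3,1) have "n dvd (c + d - 1) + (d - c + 1) - 2 * (d - h)"
    by (rule dvd_diff[OF dvd_add dvd_mult])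
  then have "n dvd 2 * h" by (simp add: algebra_simps)
  with p(4) show False by contradiction
qed

text \<open>Modulo \<open>n\<close>, \<open>a - 1\<close> has square 0 and is fixed by
  multiplication by the linear coefficient \<open>v\<close> of any automorphism. These two relations
  force conjugates of powers of \<open>\<sigma>\<close> to be powers of \<open>\<sigma>\<close>
  again.\<close>

lemma regular_cyclic_subgroup_normal:
  assumes normal: "normal_cayley_digraph G S"
    and H: "regular_subgroup H A (carrier G)" "A\<lparr>carrier := H\<rparr> \<cong> G"
  shows "H \<lhd> A"
proof -
  interpret A: group A by (rule A_group)
  have sub: "subgroup H A" using H(1) by (simp add: regular_subgroup_def)
  interpret H: group "A\<lparr>carrier := H\<rparr>" by (rule subgroup.subgroup_is_group[OF sub A_group])
  have "cyclic_group G" using z_closed carrier_eq cyclic_group by blast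
  then have "cyclic_group (A\<lparr>carrier := H\<rparr>)"
    using isomorphic_group_cyclicity[OF H(2) H.is_group is_group] by blast
  moreover have "finite H"
    using H(2) fin by (auto simp: is_iso_def iso_def dest: bij_betw_finite)
  ultimately obtain \<sigma> where "\<sigma> \<in> H" "H = range (\<lambda>k::nat. \<sigma> [^]\<^bsub>A\<lparr>carrier := H\<rparr>\<^esub> k)"
    using H.finite_cyclic_group_nat_pow by auto
  then have \<sigma>: "\<sigma> \<in> digraph_auts \<Gamma>" and H_eq: "H = range (\<lambda>k::nat. \<sigma> [^]\<^bsub>A\<^esub> k)"
    using subgroup.subset[OF sub] by (auto simp: nat_pow_def)
  obtain a b where ab: "affine \<sigma> a b" using normal_imp_affine[OF normal \<sigma>] by blast
  interpret full_cycle n a b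
    by (rule regular_affine_full_cycle[OF H(1) \<sigma> ab H_eq])
  let ?m = "a - 1"
  have m2: "n dvd 2 * ?m" by (rule full_cycle_dvd[OF normal \<sigma> ab full_cycle_axioms])
  then have mm: "n dvd ?m * ?m" by (rule square_diff_dvd)
  obtain k0 where b': "n dvd b * geo a k0 - 1" using surj by blast
  have "f \<otimes>\<^bsub>A\<^esub> \<eta> \<otimes>\<^bsub>A\<^esub> inv\<^bsub>A\<^esub> f \<in> H" if f: "f \<in> digraph_auts \<Gamma>" and "\<eta> \<in> H" for f \<eta>
  proof -
    from \<open>\<eta> \<in> H\<close> obtain k :: nat where \<eta>: "\<eta> = \<sigma> [^]\<^bsub>A\<^esub> k" using H_eq by blast
    note \<eta>_aut = affine_power(1)[OF ab \<sigma>, of k, folded \<eta>]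
    obtain v c where vc: "affine f v c" using normal_imp_affine[OF normal f] by blast
    \<comment> \<open>For odd \<open>v\<close>, \<open>v - 1\<close> supplies the 2 in
      \<open>m2\<close>. For even \<open>v\<close>, \<open>m2\<close> gives
      \<open>v * (a - 1) = 0\<close>, and injectivity of \<open>f\<close> gives
      \<open>a - 1 = 0\<close>, modulo \<open>n\<close>.\<close>
    have mv: "n dvd ?m * (v - 1)"
    proof (cases "even v")
      case True
      then obtain u where "v = 2 * u" by blast
      then have "v * ?m = 2 * ?m * u" by simp
      then have "n dvd v * ?m" using m2 by (simp only: dvd_mult2)
      then have "n dvd ?m" by (rule affine_inj[OF vc f])
      then show ?thesis by simp
    next
      case False
      then obtain u where "v = 2 * u + 1" by (rule oddE)
      then have "?m * (v - 1) = 2 * ?m * u" by simp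
      then show ?thesis using m2 by (simp only: dvd_mult2)
    qed
    let ?t = "geo a k" and ?b' = "geo a k0"
    \<comment> \<open>\<open>\<sigma> ^ k\<close> is \<open>x \<mapsto> x + t * ((a - 1) * x + b)\<close> with \<open>t = geo a k\<close>; conjugation by
      \<open>x \<mapsto> v * x + c\<close> replaces \<open>t\<close> by \<open>t'\<close>, where \<open>b'\<close> inverts \<open>b\<close> modulo \<open>n\<close>.\<close>
    define t' where "t' = v * ?t * (1 - ?m * c * ?b')"
    obtain l where l: "n dvd geo a l - t'" using geo_surj by blast
    let ?\<eta>' = "\<sigma> [^]\<^bsub>A\<^esub> l"
    note \<eta>'_aut = affine_power(1)[OF ab \<sigma>, of l]
    have "f (\<eta> (z [^] i)) = ?\<eta>' (f (z [^] i))" for i :: int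
    proof -
      have L: "f (\<eta> (z [^] i)) = z [^] (v * (a ^ k * i + b * ?t) + c)"
        using affine_power(2)[OF ab \<sigma>, of k] vc by (simp add: affine_def \<eta>)
      have R: "?\<eta>' (f (z [^] i)) = z [^] (a ^ l * (v * i + c) + b * geo a l)"
        using affine_power(2)[OF ab \<sigma>, of l] vc by (simp add: affine_def)
      let ?w = "v * i + c"
      \<comment> \<open>These four multiples of \<open>n\<close> combine to the exact difference of
        the exponents in \<open>R\<close> and \<open>L\<close>.\<close>
      have "n dvd (geo a l - t') * (?m * ?w + b)" "n dvd ?m * (v - 1) * (v * ?t * i)"
        "n dvd ?m * ?m * (c * ?b' * v * ?t * ?w)" "n dvd (b * ?b' - 1) * (?m * c * v * ?t)"
        using l mv mm b' by (simp_all only: dvd_mult2)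
      then have "n dvd (geo a l - t') * (?m * ?w + b) + ?m * (v - 1) * (v * ?t * i)
          - ?m * ?m * (c * ?b' * v * ?t * ?w) - (b * ?b' - 1) * (?m * c * v * ?t)"
        by (rule dvd_diff[OF dvd_diff[OF dvd_add]])
      also have "\<dots> = (a ^ l * ?w + b * geo a l) - (v * (a ^ k * i + b * ?t) + c)"
        unfolding power_eq_geo[of a] t'_def by (simp add: algebra_simps)
      finally show ?thesis unfolding L R pow_eq_iff by (simp only: dvd_diff_commute)
    qed
    then have "f \<otimes>\<^bsub>A\<^esub> \<eta> = ?\<eta>' \<otimes>\<^bsub>A\<^esub> f"
      using f \<eta>_aut \<eta>'_aut A.m_closed[of f \<eta>] A.m_closed[of ?\<eta>' f]
      by (intro auts_eqI) (simp_all add: Aut_mult_apply)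
    then have "f \<otimes>\<^bsub>A\<^esub> \<eta> \<otimes>\<^bsub>A\<^esub> inv\<^bsub>A\<^esub> f = ?\<eta>'"
      using f \<eta>'_aut A.inv_solve_right'[of ?\<eta>' "f \<otimes>\<^bsub>A\<^esub> \<eta>" f] A.m_closed[of f \<eta>] \<eta>_aut
      by simp
    then show ?thesis using H_eq by simp
  qed
  then show ?thesis using sub by (simp add: A.normal_inv_iff)
qed

end

theorem theorem1p1:
  fixes G :: "('a, 'b) monoid_scheme"
  assumes "group G" and "finite (carrier G)" and "cyclic_group G"
  shows "\<not> NNND_group G"
proof
  assume "NNND_group G"
  then obtain S where S: "S \<subseteq> carrier G" "NNN_cayley_digraph G S"
    by (auto simp: NNND_group_def)
  obtain z where "z \<in> carrier G" "carrier G = range (\<lambda>i::int. z [^]\<^bsub>G\<^esub> i)"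
    using group.cyclic_group assms(1,3) by blast
  then interpret finite_cyclic_cayley G z S
    using assms S by (simp add: finite_cyclic_cayley_def finite_cyclic_cayley_axioms_def)
  show False
    using S(2) regular_cyclic_subgroup_normal by (auto simp: NNN_cayley_digraph_def)
qed

end
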